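(* Let $q\ge1$, let $F,G:\mathbb{R}^n\to\mathbb{R}$ be $C^q$ functions, and for each $x\in\mathbb{R}^n$ let $\Pi(x)$ be an antisymmetric real $n\times n$ matrix depending on $x$ in a $C^q$ manner, such that the vector fields $x\mapsto\Pi(x)\nabla F(x)$ and $x\mapsto \Pi(x)\nabla G(x)$ are of class $C^1$. Let $\Phi^F_t(x)$ and $\Phi^G_t(x)$ be the solutions of $$\dot x=\Pi(x)\nabla F(x)\qquad\text{and}\qquad \dot x=\Pi(x)\nabla G(x),$$ respectively, with $\Phi^F_0(x)=x=\Phi^G_0(x)$. If $G$ is a conserved quantity for $\dot x=\Pi(x)\nabla F(x)$, then for all initial conditions $x\in\{x\in\mathbb{R}^n\mid\nabla F(x)=\nabla G(x)\}$ we have $\Phi^F_t(x)=\Phi^G_t(x)$ for all $t$.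
   Context: A function $G:\mathbb{R}^n\to\mathbb{R}$ is a conserved quantity for a differential equation if it is constant along each of its solutions. "For all $t$" means for all $t$ in the (maximal) interval of existence of the solutions. *)

theory Defs
  imports "HOL-Analysis.Analysis"
begin

text \<open>
  Since the domain is finite-dimensional, a function is of class \<open>C\<^sup>k\<^sup>+\<^sup>1\<close> iff it is Frechet
  differentiable and, for every fixed direction \<open>v\<close>, its derivative in direction \<open>v\<close> is of class
  \<open>C\<^sup>k\<close>. Recursing on directional derivatives keeps the codomain type fixed.
\<close>

primrec C_class :: "nat \<Rightarrow> ('a::euclidean_space \<Rightarrow> 'b::real_normed_vector) \<Rightarrow> bool" where
  "C_class 0 f \<longleftrightarrow> continuous_on UNIV f"
| "C_class (Suc k) f \<longleftrightarrow>
     (\<forall>x. f differentiable (at x)) \<and> (\<forall>v. C_class k (\<lambda>x. frechet_derivative f (at x) v))"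

definition gradient :: "('a::real_inner \<Rightarrow> real) \<Rightarrow> 'a \<Rightarrow> 'a" where
  "gradient f x = (THE D. GDERIV f x :> D)"

lemma gradient_eqI:
  assumes "GDERIV f x :> D"
  shows "gradient f x = D"
  unfolding gradient_def
proof (rule the_equality)
  show "GDERIV f x :> D" by (fact assms)
next
  fix E assume "GDERIV f x :> E"
  with assms have "(\<lambda>h. h \<bullet> E) = (\<lambda>h. h \<bullet> D)"
    unfolding gderiv_def by (intro has_derivative_unique)
  then have "\<forall>h. h \<bullet> E = h \<bullet> D"
    by (rule fun_cong[THEN allI])
  then show "E = D"
    by (rule vector_eq_ldot[THEN iffD1])
qed

lemma gradient_component:
  fixes f :: "real ^ 'n \<Rightarrow> real"
  assumes "f differentiable (at x)"
  shows "gradient f x = (\<chi> i. frechet_derivative f (at x) (axis i 1))"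
proof (rule gradient_eqI)
  let ?f' = "frechet_derivative f (at x)"
  have d: "(f has_derivative ?f') (at x)"
    using assms frechet_derivative_works by blast
  then interpret f': linear ?f'
    by (rule has_derivative_linear)
  have "?f' h = h \<bullet> (\<chi> i. ?f' (axis i 1))" for h
  proof -
    have "?f' h = ?f' (\<Sum>i\<in>UNIV. (h $ i) *\<^sub>R axis i 1)"
      using basis_expansion[of h] by (simp add: scalar_mult_eq_scaleR)
    also have "\<dots> = (\<Sum>i\<in>UNIV. h $ i * ?f' (axis i 1))"
      by (simp add: f'.sum f'.scale)
    finally show ?thesis
      by (simp add: inner_vec_def)
  qed
  then show "GDERIV f x :> (\<chi> i. ?f' (axis i 1))"
    unfolding gderiv_def by (intro has_derivative_eq_rhs[OF d] ext)
qed

definition solution_on ::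
    "('a::real_normed_vector \<Rightarrow> 'a) \<Rightarrow> real set \<Rightarrow> (real \<Rightarrow> 'a) \<Rightarrow> bool" where
  "solution_on X I \<phi> \<longleftrightarrow>
     open I \<and> is_interval I \<and> I \<noteq> {} \<and> (\<forall>t\<in>I. (\<phi> has_vector_derivative X (\<phi> t)) (at t))"

text \<open>The values of \<open>\<phi>\<close> outside \<open>I\<close> are irrelevant.\<close>

definition maximal_solution ::
    "('a::real_normed_vector \<Rightarrow> 'a) \<Rightarrow> 'a \<Rightarrow> real set \<Rightarrow> (real \<Rightarrow> 'a) \<Rightarrow> bool" where
  "maximal_solution X x I \<phi> \<longleftrightarrow>
     solution_on X I \<phi> \<and> 0 \<in> I \<and> \<phi> 0 = x \<and>
     (\<forall>J \<psi>. solution_on X J \<psi> \<and> I \<subseteq> J \<and> (\<forall>t\<in>I. \<psi> t = \<phi> t) \<longrightarrow> J = I)"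

definition conserved_quantity ::
    "('a::real_normed_vector \<Rightarrow> 'a) \<Rightarrow> ('a \<Rightarrow> real) \<Rightarrow> bool" where
  "conserved_quantity X G \<longleftrightarrow>
     (\<forall>I \<phi>. solution_on X I \<phi> \<longrightarrow> (\<lambda>t. G (\<phi> t)) constant_on I)"

end

theory Submission
  imports Defs
begin

text \<open>
  Write \<open>X\<^sub>F = \<Pi>\<nabla>F\<close> and \<open>X\<^sub>G = \<Pi>\<nabla>G\<close>. Antisymmetry of \<open>\<Pi>\<close> makes \<open>F\<close> conserved along \<open>X\<^sub>F\<close>, and
  \<open>G\<close> is so by hypothesis; hence the difference \<open>h = F - G\<close> is conserved along \<open>X\<^sub>F\<close>. The flow
  \<open>\<phi>\<^sub>t\<close> of a vector field carries critical points of a conserved quantity \<open>h\<close> to critical points: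
  from \<open>h \<circ> \<phi>\<^sub>t = h\<close> and the invertibility of \<open>\<phi>\<^sub>t\<close>, \<open>\<nabla>h\<close> vanishes at \<open>\<phi>\<^sub>t x\<close> if it vanishes at
  \<open>x\<close>. So an \<open>X\<^sub>F\<close>-solution that starts where \<open>\<nabla>F = \<nabla>G\<close> remains there, is also an
  \<open>X\<^sub>G\<close>-solution, and by uniqueness is contained in the maximal \<open>X\<^sub>G\<close>-solution.

  The converse inclusion is the same argument with the roles exchanged, which requires that \<open>F\<close>
  be conserved along \<open>X\<^sub>G\<close>. This follows from antisymmetry once the conservation of \<open>G\<close> along
  \<open>X\<^sub>F\<close> is known in its pointwise form \<open>\<nabla>G \<bullet> \<Pi>\<nabla>F = 0\<close>; to extract the pointwise form one needs
  a solution through every point (\<open>conserved_quantity_iff_gradient_orthogonal\<close>).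

  Differentiability of the flow in the initial condition can be avoided. If \<open>\<nabla>h = 0\<close> at \<open>b\<close>, and
  the flow carries points \<open>y\<close> near \<open>c\<close> to points \<open>y'\<close> near \<open>b\<close>, then
  \<open>h y - h c = h y' - h b = o(\<bar>y' - b\<bar>)\<close>, and Lipschitz dependence on the initial condition makes
  this \<open>o(\<bar>y - c\<bar>)\<close>; thus \<open>\<nabla>h = 0\<close> at \<open>c\<close> (\<open>critical_points_propagate\<close>). All that is used of the
  theory of differential equations is therefore short-time existence (\<open>local_flow_box\<close>),
  short-time Lipschitz dependence (\<open>solutions_stable_short_time\<close>), and their consequence that a
  maximal solution extends every other solution with the same initial value. Statements valid for
  short times are spread over a whole interval of existence by showing that a property of the time
  is locally constant.
\<close>

section \<open>Short-time behaviour of solutions of Lipschitz equations\<close>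

definition locally_lipschitz :: "('a::metric_space \<Rightarrow> 'b::metric_space) \<Rightarrow> bool" where
  "locally_lipschitz X \<longleftrightarrow> (\<forall>x. \<exists>R>0. \<exists>L. L-lipschitz_on (cball x R) X)"

lemma vector_derivative_mean_value_bound:
  fixes f :: "real \<Rightarrow> 'a::real_normed_vector"
  assumes "convex T"
    and "\<And>t. t \<in> T \<Longrightarrow> (f has_vector_derivative f' t) (at t within T)"
    and "\<And>t. t \<in> T \<Longrightarrow> norm (f' t) \<le> B"
    and "s \<in> T" "t \<in> T"
  shows "norm (f s - f t) \<le> B * \<bar>s - t\<bar>"
proof -
  have "norm (f s - f t) \<le> B * norm (s - t)"
  proof (rule differentiable_bound[OF \<open>convex T\<close> _ _ \<open>s \<in> T\<close> \<open>t \<in> T\<close>])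
    show "(f has_derivative (\<lambda>h. h *\<^sub>R f' u)) (at u within T)" if "u \<in> T" for u
      using assms(2)[OF that] by (simp add: has_vector_derivative_def)
    show "onorm (\<lambda>h. h *\<^sub>R f' u) \<le> B" if "u \<in> T" for u
      using assms(3)[OF that]
      by (intro onorm_le) (simp add: mult.commute[of B] mult_left_mono)
  qed
  then show ?thesis by simp
qed

text \<open>
  The maximum of \<open>\<bar>f - g\<bar>\<close> on the segment exceeds its initial value by at most
  \<open>L * \<bar>b - a\<bar> \<le> 1/2\<close> times itself, by the mean value inequality. For such short times this
  replaces Gronwall's inequality; it gives both uniqueness and Lipschitz dependence on the initial
  value, forwards and backwards in time.
\<close>

lemma solutions_stable_short_time:
  fixes f g :: "real \<Rightarrow> 'a::real_normed_vector"
  assumes lip: "L-lipschitz_on S X"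
    and short: "L * \<bar>b - a\<bar> \<le> 1/2"
    and f: "\<And>t. t \<in> closed_segment a b \<Longrightarrow> (f has_vector_derivative X (f t)) (at t)"
    and g: "\<And>t. t \<in> closed_segment a b \<Longrightarrow> (g has_vector_derivative X (g t)) (at t)"
    and fS: "\<And>t. t \<in> closed_segment a b \<Longrightarrow> f t \<in> S"
    and gS: "\<And>t. t \<in> closed_segment a b \<Longrightarrow> g t \<in> S"
  shows "dist (f b) (g b) \<le> 2 * dist (f a) (g a)"
proof -
  let ?T = "closed_segment a b" and ?u = "\<lambda>t. f t - g t"
  have u': "(?u has_vector_derivative (X (f t) - X (g t))) (at t within ?T)" if "t \<in> ?T" for t
    by (rule has_vector_derivative_at_within[OF has_vector_derivative_diff[OF f[OF that] g[OF that]]])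
  have "continuous_on ?T ?u"
    unfolding continuous_on_eq_continuous_within
    by (intro ballI has_vector_derivative_continuous[OF u'])
  then have "continuous_on ?T (\<lambda>t. norm (?u t))"
    by (rule continuous_on_norm)
  then obtain m where m: "m \<in> ?T" and max: "\<And>t. t \<in> ?T \<Longrightarrow> norm (?u t) \<le> norm (?u m)"
    using continuous_attains_sup[of ?T "\<lambda>t. norm (?u t)"] by auto
  have L: "0 \<le> L"
    using lip by (rule lipschitz_on_nonneg)
  have "norm (?u m - ?u a) \<le> L * norm (?u m) * \<bar>m - a\<bar>"
  proof (rule vector_derivative_mean_value_bound[OF _ u' _ m])
    show "norm (X (f t) - X (g t)) \<le> L * norm (?u m)" if "t \<in> ?T" for t
      using lipschitz_on_normD[OF lip fS[OF that] gS[OF that]] max[OF that] L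
      by (meson mult_left_mono order_trans)
  qed auto
  also have "\<dots> \<le> L * norm (?u m) * \<bar>b - a\<bar>"
    using segment_bound(1)[OF m] L by (intro mult_left_mono) auto
  also have "\<dots> = (L * \<bar>b - a\<bar>) * norm (?u m)"
    by simp
  also have "\<dots> \<le> 1/2 * norm (?u m)"
    using short by (rule mult_right_mono) simp
  finally have "norm (?u m) \<le> 2 * norm (?u a)"
    using norm_triangle_sub[of "?u m" "?u a"] by simp
  then show ?thesis
    using max[of b] by (simp add: dist_norm)
qed

text \<open>
  The Picard operator sends \<open>\<psi>\<close> to \<open>y\<close> plus the integral of \<open>Y \<circ> \<psi>\<close> from \<open>0\<close> to \<open>t\<close>. It acts on
  bounded continuous functions on the whole line once its values are extended constantly beyond
  \<open>[-d, d]\<close>, and it is a contraction there. The integral from \<open>0\<close> is written as a difference of two integrals from \<open>-d\<close>,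
  so that negative times need no separate treatment; the price is the factor \<open>8\<close> in the bound on
  \<open>d\<close>: each of the two integrals runs over a length of at most \<open>2 * d\<close>, and the contraction
  constant is to be \<open>1/2\<close>.
\<close>

lemma picard_globally_lipschitz:
  fixes Y :: "'a::euclidean_space \<Rightarrow> 'a"
  assumes lip: "L-lipschitz_on UNIV Y" and "0 < d" and short: "8 * (L * d) \<le> 1"
  obtains \<psi> where "\<psi> 0 = y"
    and "\<And>t. t \<in> {-d<..<d} \<Longrightarrow> (\<psi> has_vector_derivative Y (\<psi> t)) (at t)"
proof -
  have contY: "continuous_on UNIV Y"
    using lip by (rule lipschitz_on_continuous_on)
  have contYf: "continuous_on S (\<lambda>s. Y (apply_bcontfun f s))" for S and f :: "real \<Rightarrow>\<^sub>C 'a"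
    by (rule continuous_on_compose2[OF contY]) auto
  define A where "A f t = integral {-d..t} (\<lambda>s. Y (apply_bcontfun f s))" for f and t :: real
  define B where "B f t = y + (A f t - A f 0)" for f t
  have A': "(A f has_vector_derivative Y (apply_bcontfun f t)) (at t within {-d..d})"
    if "t \<in> {-d..d}" for f t
    unfolding A_def using integral_has_vector_derivative[OF contYf that] .
  have B': "(B f has_vector_derivative Y (apply_bcontfun f t)) (at t within {-d..d})"
    if "t \<in> {-d..d}" for f t
    unfolding B_def using has_vector_derivative_add[OF has_vector_derivative_const
      has_vector_derivative_diff[OF A'[OF that] has_vector_derivative_const]] by auto
  have "\<exists>g. \<forall>t. apply_bcontfun g t = B f (clamp (-d) d t)" for f
  proof -
    have "continuous_on (cbox (-d) d) (B f)"
      unfolding continuous_on_eq_continuous_within cbox_interval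
      by (intro ballI has_vector_derivative_continuous[OF B'])
    then show ?thesis
      by (rule continuous_on_cbox_bcontfunE) blast
  qed
  then obtain \<T> where \<T>: "\<And>f t. apply_bcontfun (\<T> f) t = B f (clamp (-d) d t)"
    by metis
  have L: "0 \<le> L"
    using lip by (rule lipschitz_on_nonneg)
  have A_lip: "norm (A f t - A g t) \<le> 1/4 * dist f g" if t: "t \<in> {-d..d}" for f g t
  proof -
    have "A f t - A g t = integral {-d..t} (\<lambda>s. Y (apply_bcontfun f s) - Y (apply_bcontfun g s))"
      unfolding A_def
      by (intro integral_diff[symmetric] integrable_continuous_real contYf)
    also have "norm \<dots> \<le> (L * dist f g) * (t - (-d))"
    proof (rule integral_bound)
      fix s
      show "norm (Y (apply_bcontfun f s) - Y (apply_bcontfun g s)) \<le> L * dist f g"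
        using lipschitz_onD[OF lip, of "apply_bcontfun f s" "apply_bcontfun g s"]
          mult_left_mono[OF dist_bounded[of f s g] L]
        by (simp add: dist_norm)
    qed (use t in \<open>auto intro!: continuous_on_diff contYf\<close>)
    also have "\<dots> \<le> (L * dist f g) * (2 * d)"
      using t L by (intro mult_left_mono) auto
    also have "\<dots> = (2 * (L * d)) * dist f g"
      by simp
    also have "\<dots> \<le> 1/4 * dist f g"
      using short by (intro mult_right_mono) auto
    finally show ?thesis .
  qed
  have "dist (\<T> f) (\<T> g) \<le> 1/2 * dist f g" for f g
  proof (rule dist_bound)
    fix t
    let ?t = "clamp (-d) d t"
    have t: "?t \<in> {-d..d}"
      using clamp_in_interval[of "-d" d t] \<open>0 < d\<close> by (simp add: cbox_interval)
    have "dist (apply_bcontfun (\<T> f) t) (apply_bcontfun (\<T> g) t)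
        = norm ((A f ?t - A g ?t) - (A f 0 - A g 0))"
      by (simp add: \<T> B_def dist_norm algebra_simps)
    also have "\<dots> \<le> norm (A f ?t - A g ?t) + norm (A f 0 - A g 0)"
      by (rule norm_triangle_ineq4)
    also have "\<dots> \<le> 1/2 * dist f g"
      using A_lip[OF t, of f g] A_lip[of 0 f g] \<open>0 < d\<close> by simp
    finally show "dist (apply_bcontfun (\<T> f) t) (apply_bcontfun (\<T> g) t) \<le> 1/2 * dist f g" .
  qed
  then obtain f where f: "\<T> f = f"
    using banach_fix_type[of "1/2" \<T>] by auto
  have fB: "apply_bcontfun f t = B f t" if "t \<in> {-d..d}" for t
    using \<T>[of f t] that by (simp add: f cbox_interval)
  show thesis
  proof
    show "apply_bcontfun f 0 = y"
      using fB[of 0] \<open>0 < d\<close> by (simp add: B_def)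
    fix t assume t: "t \<in> {-d<..<d}"
    then have "(B f has_vector_derivative Y (apply_bcontfun f t)) (at t within {-d<..<d})"
      using B'[of t f] by (auto intro: has_vector_derivative_within_subset)
    then have "(B f has_vector_derivative Y (apply_bcontfun f t)) (at t)"
      unfolding at_within_open[OF t open_greaterThanLessThan] .
    then show "(apply_bcontfun f has_vector_derivative Y (apply_bcontfun f t)) (at t)"
      by (rule has_vector_derivative_transform_within_open[where S = "{-d<..<d}"])
        (use t fB in auto)
  qed
qed

text \<open>
  Composing \<open>X\<close> with the nearest-point projection onto the ball, which has Lipschitz constant
  \<open>1\<close>, gives a globally Lipschitz field \<open>Y\<close> bounded by some \<open>M\<close>. In time \<open>R / (2 * M)\<close> a
  \<open>Y\<close>-solution started in the half-sized ball cannot leave the ball, where \<open>Y = X\<close>. The existence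
  time \<open>d\<close> is common to all these initial points, as the comparison of a given solution with all
  nearby ones requires.
\<close>

lemma local_flow_box:
  fixes X :: "'a::euclidean_space \<Rightarrow> 'a"
  assumes "0 < R" and lip: "L-lipschitz_on (cball x\<^sub>0 R) X"
  obtains d where "0 < d" "L * d \<le> 1/2"
    and "\<And>y. y \<in> cball x\<^sub>0 (R/2) \<Longrightarrow>
      \<exists>\<psi>. solution_on X {-d<..<d} \<psi> \<and> \<psi> 0 = y \<and> \<psi> ` {-d<..<d} \<subseteq> cball x\<^sub>0 R"
proof -
  let ?K = "cball x\<^sub>0 R"
  define Y where "Y = X \<circ> closest_point ?K"
  define M where "M = norm (X x\<^sub>0) + L * R"
  \<comment> \<open>The summands \<open>1\<close> only keep the denominators positive if \<open>L\<close> or \<open>M\<close> vanishes.\<close>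
  define d where "d = min (1 / (8 * (L + 1))) (R / (2 * (M + 1)))"
  have K: "convex ?K" "closed ?K" "?K \<noteq> {}"
    using \<open>0 < R\<close> by auto
  have L: "0 \<le> L"
    using lip by (rule lipschitz_on_nonneg)
  have M: "0 \<le> M"
    using L \<open>0 < R\<close> by (simp add: M_def)
  have d: "0 < d"
    using L M \<open>0 < R\<close> by (simp add: d_def)
  have "8 * (L + 1) * d \<le> 8 * (L + 1) * (1 / (8 * (L + 1)))"
    using L by (intro mult_left_mono) (auto simp: d_def)
  then have Ld: "8 * (L * d) \<le> 1"
    using L d by (simp add: field_simps)
  have "2 * (M + 1) * d \<le> 2 * (M + 1) * (R / (2 * (M + 1)))"
    using M by (intro mult_left_mono) (auto simp: d_def)
  also have "\<dots> = R"
    using M by simp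
  finally have "2 * (M + 1) * d \<le> R" .
  then have Md: "M * d \<le> R / 2"
    using d by (simp add: algebra_simps)
  have inK: "closest_point ?K z \<in> ?K" for z
    using K by (intro closest_point_in_set)
  have Ylip: "L-lipschitz_on UNIV Y"
  proof (rule lipschitz_onI[OF _ L])
    fix u v
    have "dist (Y u) (Y v) \<le> L * dist (closest_point ?K u) (closest_point ?K v)"
      unfolding Y_def o_def using lip inK inK by (rule lipschitz_onD)
    also have "\<dots> \<le> L * dist u v"
      using K L by (intro mult_left_mono closest_point_lipschitz)
    finally show "dist (Y u) (Y v) \<le> L * dist u v" .
  qed
  have Ybound: "norm (Y z) \<le> M" for z
  proof -
    let ?c = "closest_point ?K z"
    have "norm (X ?c - X x\<^sub>0) \<le> L * norm (?c - x\<^sub>0)"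
      using lip inK by (rule lipschitz_on_normD) (use \<open>0 < R\<close> in auto)
    also have "\<dots> \<le> L * R"
      using inK[of z] L by (intro mult_left_mono) (auto simp: dist_norm norm_minus_commute)
    finally show ?thesis
      using norm_triangle_sub[of "X ?c" "X x\<^sub>0"] by (simp add: Y_def M_def)
  qed
  show thesis
  proof
    show "0 < d" by (fact d)
    show "L * d \<le> 1/2" using Ld by simp
    fix y assume y: "y \<in> cball x\<^sub>0 (R/2)"
    obtain \<psi> where \<psi>0: "\<psi> 0 = y"
      and \<psi>: "\<And>t. t \<in> {-d<..<d} \<Longrightarrow> (\<psi> has_vector_derivative Y (\<psi> t)) (at t)"
      using picard_globally_lipschitz[OF Ylip d Ld] by blast
    have stay: "\<psi> t \<in> ?K" if t: "t \<in> {-d<..<d}" for t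
    proof -
      have "norm (\<psi> t - \<psi> 0) \<le> M * \<bar>t - 0\<bar>"
        by (rule vector_derivative_mean_value_bound[where T = "{-d<..<d}" and f' = "\<lambda>t. Y (\<psi> t)"])
          (use t d in \<open>auto intro!: Ybound has_vector_derivative_at_within[OF \<psi>]\<close>)
      also have "\<dots> \<le> M * d"
        using t M by (intro mult_left_mono) auto
      finally have "dist (\<psi> t) y \<le> R / 2"
        using Md by (simp add: \<psi>0 dist_norm)
      then show ?thesis
        using y dist_triangle[of x\<^sub>0 "\<psi> t" y] by (simp add: dist_commute)
    qed
    have "Y (\<psi> t) = X (\<psi> t)" if "t \<in> {-d<..<d}" for t
      using stay[OF that] by (simp add: Y_def closest_point_self)
    then have "solution_on X {-d<..<d} \<psi>"
      using \<psi> d by (auto simp: solution_on_def)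
    then show "\<exists>\<psi>. solution_on X {-d<..<d} \<psi> \<and> \<psi> 0 = y \<and> \<psi> ` {-d<..<d} \<subseteq> ?K"
      using \<psi>0 stay by blast
  qed
qed

lemma solution_through_point:
  fixes X :: "'a::euclidean_space \<Rightarrow> 'a"
  assumes "locally_lipschitz X"
  obtains I \<phi> where "solution_on X I \<phi>" "0 \<in> I" "\<phi> 0 = x"
proof -
  obtain R L where "0 < R" and "L-lipschitz_on (cball x R) X"
    using assms unfolding locally_lipschitz_def by blast
  then show thesis
  proof (rule local_flow_box)
    fix d
    assume d: "0 < d" and flow: "\<And>y. y \<in> cball x (R/2) \<Longrightarrow>
      \<exists>\<psi>. solution_on X {-d<..<d} \<psi> \<and> \<psi> 0 = y \<and> \<psi> ` {-d<..<d} \<subseteq> cball x R"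
    obtain \<psi> where "solution_on X {-d<..<d} \<psi>" "\<psi> 0 = x"
      using flow[of x] \<open>0 < R\<close> by auto
    then show thesis
      using d by (intro that[of "{-d<..<d}" \<psi>]) auto
  qed
qed

section \<open>Uniqueness and maximality\<close>

lemma solution_on_continuous:
  assumes "solution_on X I \<phi>" "t \<in> I"
  shows "isCont \<phi> t"
  using assms has_vector_derivative_continuous unfolding solution_on_def by blast

lemma solution_on_stays_near:
  assumes "solution_on X I \<phi>" "t\<^sub>0 \<in> I" "0 < r"
  obtains e where "0 < e" "\<And>t. \<bar>t - t\<^sub>0\<bar> < e \<Longrightarrow> t \<in> I \<and> \<phi> t \<in> ball (\<phi> t\<^sub>0) r"
proof -
  have "eventually (\<lambda>t. t \<in> I) (nhds t\<^sub>0)"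
    using assms by (intro eventually_nhds_in_open) (auto simp: solution_on_def)
  moreover have "eventually (\<lambda>t. \<phi> t \<in> ball (\<phi> t\<^sub>0) r) (nhds t\<^sub>0)"
    using solution_on_continuous[OF assms(1,2)] \<open>0 < r\<close>
    by (intro topological_tendstoD[of \<phi> "\<phi> t\<^sub>0"])
      (auto simp: isCont_def tendsto_at_iff_tendsto_nhds)
  ultimately have "eventually (\<lambda>t. t \<in> I \<and> \<phi> t \<in> ball (\<phi> t\<^sub>0) r) (nhds t\<^sub>0)"
    by (rule eventually_conj)
  then show thesis
    using that by (auto simp: eventually_nhds_metric dist_real_def)
qed

text \<open>
  Whether \<open>\<phi>\<close> and \<open>\<psi>\<close> agree is locally constant in time: agreement persists for a short time by
  stability, disagreement by continuity.
\<close>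

lemma solutions_unique:
  fixes X :: "'a::euclidean_space \<Rightarrow> 'a"
  assumes X: "locally_lipschitz X"
    and \<phi>: "solution_on X I \<phi>" and \<psi>: "solution_on X J \<psi>"
    and s: "s \<in> I \<inter> J" and t: "t \<in> I \<inter> J" and eq: "\<phi> s = \<psi> s"
  shows "\<phi> t = \<psi> t"
proof -
  have "connected (I \<inter> J)"
    using \<phi> \<psi> by (intro is_interval_connected is_interval_Int) (auto simp: solution_on_def)
  then have "(\<phi> s = \<psi> s) = (\<phi> t = \<psi> t)"
    using s t
  proof (rule connected_local_const[where f = "\<lambda>t. \<phi> t = \<psi> t"], intro ballI)
    fix a assume a: "a \<in> I \<inter> J"
    show "eventually (\<lambda>b. (\<phi> a = \<psi> a) = (\<phi> b = \<psi> b)) (at a within I \<inter> J)"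
    proof (cases "\<phi> a = \<psi> a")
      case True
      obtain R L where R: "0 < R" and lip: "L-lipschitz_on (cball (\<phi> a) R) X"
        using X unfolding locally_lipschitz_def by blast
      have L: "0 \<le> L"
        using lip by (rule lipschitz_on_nonneg)
      obtain e1 where e1: "0 < e1" "\<And>t. \<bar>t - a\<bar> < e1 \<Longrightarrow> t \<in> I \<and> \<phi> t \<in> ball (\<phi> a) R"
        using solution_on_stays_near[OF \<phi> _ R] a by blast
      obtain e2 where e2: "0 < e2" "\<And>t. \<bar>t - a\<bar> < e2 \<Longrightarrow> t \<in> J \<and> \<psi> t \<in> ball (\<psi> a) R"
        using solution_on_stays_near[OF \<psi> _ R] a by blast
      define e where "e = min (min e1 e2) (1 / (2 * (L + 1)))"
      have e: "0 < e" "e \<le> e1" "e \<le> e2" and "e \<le> 1 / (2 * (L + 1))"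
        using e1 e2 L by (auto simp: e_def)
      then have Le: "L * e \<le> 1/2"
        using L by (simp add: field_simps)
      have "\<phi> b = \<psi> b" if b: "\<bar>b - a\<bar> < e" for b
      proof -
        have near: "\<bar>t - a\<bar> < e" if "t \<in> closed_segment a b" for t
          using segment_bound(1)[OF that] b by simp
        have "dist (\<phi> b) (\<psi> b) \<le> 2 * dist (\<phi> a) (\<psi> a)"
        proof (rule solutions_stable_short_time[OF lip])
          show "L * \<bar>b - a\<bar> \<le> 1/2"
            using mult_left_mono[of "\<bar>b - a\<bar>" e L] b L Le by simp
          fix t assume "t \<in> closed_segment a b"
          from near[OF this] have t: "t \<in> I" "t \<in> J" "\<phi> t \<in> ball (\<phi> a) R" "\<psi> t \<in> ball (\<psi> a) R"
            using e1(2)[of t] e2(2)[of t] e by auto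
          show "(\<phi> has_vector_derivative X (\<phi> t)) (at t)" "(\<psi> has_vector_derivative X (\<psi> t)) (at t)"
            using t \<phi> \<psi> by (auto simp: solution_on_def)
          show "\<phi> t \<in> cball (\<phi> a) R" "\<psi> t \<in> cball (\<phi> a) R"
            using t True by auto
        qed
        then show ?thesis using True by simp
      qed
      then show ?thesis
        using True e(1) by (auto simp: eventually_at dist_real_def intro!: exI[of _ e])
    next
      case False
      have "isCont (\<lambda>t. \<phi> t - \<psi> t) a"
        using a by (intro isCont_diff solution_on_continuous[OF \<phi>] solution_on_continuous[OF \<psi>]) auto
      then have "eventually (\<lambda>t. \<phi> t - \<psi> t \<noteq> 0) (at a)"
        using False by (intro tendsto_imp_eventually_ne) (auto simp: isCont_def)
      then have "eventually (\<lambda>t. \<phi> t - \<psi> t \<noteq> 0) (at a within I \<inter> J)"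
        by (rule filter_leD[OF at_le, rotated]) simp
      then show ?thesis
        using False by (auto elim: eventually_mono)
    qed
  qed
  then show ?thesis using eq by simp
qed

lemma solution_on_glue:
  assumes \<phi>: "solution_on X I \<phi>" and \<psi>: "solution_on X J \<psi>"
    and meet: "I \<inter> J \<noteq> {}" and agree: "\<And>t. t \<in> I \<inter> J \<Longrightarrow> \<phi> t = \<psi> t"
  shows "solution_on X (I \<union> J) (\<lambda>t. if t \<in> I then \<phi> t else \<psi> t)" (is "solution_on X _ ?\<chi>")
proof -
  have I: "open I" "connected I" and J: "open J" "connected J"
    using \<phi> \<psi> by (auto simp: solution_on_def is_interval_connected)
  have "is_interval (I \<union> J)"
    using connected_Un[OF I(2) J(2) meet] by (simp add: is_interval_connected_1)
  moreover have "(?\<chi> has_vector_derivative X (?\<chi> t)) (at t)" if "t \<in> I" for t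
  proof -
    have "(\<phi> has_vector_derivative X (?\<chi> t)) (at t)"
      using \<phi> that by (simp add: solution_on_def)
    then show ?thesis
      by (rule has_vector_derivative_transform_within_open[OF _ I(1) that]) simp
  qed
  moreover have "(?\<chi> has_vector_derivative X (?\<chi> t)) (at t)" if "t \<in> J" for t
  proof -
    have \<chi>: "?\<chi> s = \<psi> s" if "s \<in> J" for s
      using agree that by auto
    have "(\<psi> has_vector_derivative X (?\<chi> t)) (at t)"
      unfolding \<chi>[OF that] using \<psi> that by (auto simp: solution_on_def)
    then show ?thesis
      by (rule has_vector_derivative_transform_within_open[OF _ J(1) that]) (simp add: \<chi>)
  qed
  ultimately show ?thesis
    using I(1) J(1) meet unfolding solution_on_def by blast
qed

lemma maximal_solution_extends_solution:
  fixes X :: "'a::euclidean_space \<Rightarrow> 'a"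
  assumes X: "locally_lipschitz X"
    and max: "maximal_solution X x I \<phi>"
    and \<psi>: "solution_on X J \<psi>" "0 \<in> J" "\<psi> 0 = x"
  shows "J \<subseteq> I" and "\<And>t. t \<in> J \<Longrightarrow> \<psi> t = \<phi> t"
proof -
  have \<phi>: "solution_on X I \<phi>" "0 \<in> I" "\<phi> 0 = x"
    using max by (auto simp: maximal_solution_def)
  have no_extension: "K = I" if "solution_on X K \<xi> \<and> I \<subseteq> K \<and> (\<forall>t\<in>I. \<xi> t = \<phi> t)" for K \<xi>
    using max that unfolding maximal_solution_def by blast
  let ?\<chi> = "\<lambda>t. if t \<in> I then \<phi> t else \<psi> t"
  have agree: "\<phi> t = \<psi> t" if "t \<in> I \<inter> J" for t
    using solutions_unique[OF X \<phi>(1) \<psi>(1) _ that, of 0] \<phi> \<psi> by simp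
  have "solution_on X (I \<union> J) ?\<chi>"
    using \<phi> \<psi> agree by (intro solution_on_glue) auto
  moreover have "I \<subseteq> I \<union> J" "\<forall>t\<in>I. ?\<chi> t = \<phi> t"
    by simp_all
  ultimately have "I \<union> J = I"
    by (intro no_extension conjI)
  then show "J \<subseteq> I" by blast
  then show "\<And>t. t \<in> J \<Longrightarrow> \<psi> t = \<phi> t"
    using agree by auto
qed

section \<open>Conserved quantities and their critical points\<close>

text \<open>
  Criticality of \<open>\<phi> t\<close> is locally constant in time. Let \<open>b\<close>, \<open>c\<close> be times close to each other, and
  let \<open>\<phi> b\<close> be critical. The flow over the time \<open>b - c\<close> moves \<open>\<phi> c\<close> to \<open>\<phi> b\<close> and each
  neighbour \<open>y\<close> of \<open>\<phi> c\<close> to a point \<open>y'\<close> with the same value of \<open>h\<close> and with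
  \<open>\<bar>y' - \<phi> b\<bar> \<le> 2 * \<bar>y - \<phi> c\<bar>\<close>, so the first-order estimate for \<open>h\<close> at \<open>\<phi> b\<close> transfers to
  \<open>\<phi> c\<close>.
\<close>

lemma critical_points_propagate:
  fixes X :: "'a::euclidean_space \<Rightarrow> 'a" and h :: "'a \<Rightarrow> real"
  assumes X: "locally_lipschitz X" and h: "conserved_quantity X h"
    and \<phi>: "solution_on X I \<phi>" and s: "s \<in> I" and t: "t \<in> I"
    and crit: "(h has_derivative (\<lambda>_. 0)) (at (\<phi> s))"
  shows "(h has_derivative (\<lambda>_. 0)) (at (\<phi> t))"
proof -
  let ?crit = "\<lambda>t. (h has_derivative (\<lambda>_. 0)) (at (\<phi> t))"
  have "connected I"
    using \<phi> by (auto simp: solution_on_def is_interval_connected)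
  then have "?crit s = ?crit t"
    using s t
  proof (rule connected_local_const[where f = ?crit], intro ballI)
    fix a assume a: "a \<in> I"
    obtain R L where R: "0 < R" and lip: "L-lipschitz_on (cball (\<phi> a) R) X"
      using X unfolding locally_lipschitz_def by blast
    obtain d where d: "0 < d" "L * d \<le> 1/2"
      and flow: "\<And>y. y \<in> cball (\<phi> a) (R/2) \<Longrightarrow> \<exists>\<psi>. solution_on X {-d<..<d} \<psi> \<and> \<psi> 0 = y \<and>
        \<psi> ` {-d<..<d} \<subseteq> cball (\<phi> a) R"
      using local_flow_box[OF R lip] by metis
    obtain e1 where e1: "0 < e1" "\<And>t. \<bar>t - a\<bar> < e1 \<Longrightarrow> t \<in> I \<and> \<phi> t \<in> ball (\<phi> a) (R/2)"
      using solution_on_stays_near[OF \<phi> a, of "R/2"] R by auto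
    \<comment> \<open>Two times within \<open>d/2\<close> of \<open>a\<close> differ by less than the existence time \<open>d\<close> of the flow box.\<close>
    define e where "e = min e1 (d/2)"
    have e: "0 < e" "e \<le> e1" "2 * e \<le> d"
      using e1 d by (auto simp: e_def)
    have L: "0 \<le> L"
      using lip by (rule lipschitz_on_nonneg)
    have carry: "?crit c" if crit_b: "?crit b" and b: "\<bar>b - a\<bar> < e" and c: "\<bar>c - a\<bar> < e" for b c
    proof -
      let ?\<tau> = "b - c"
      have \<tau>: "\<bar>?\<tau>\<bar> < d"
        using b c e by linarith
      have seg: "\<bar>u\<bar> < d \<and> \<bar>c + u - a\<bar> < e" if "u \<in> closed_segment 0 ?\<tau>" for u
        using that b c \<tau> by (auto simp: closed_segment_eq_real_ivl split: if_splits)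
      have near: "\<exists>y'. h y' = h y \<and> dist y' (\<phi> b) \<le> 2 * dist y (\<phi> c)"
        if y: "y \<in> ball (\<phi> a) (R/2)" for y
      proof -
        obtain \<psi> where \<psi>: "solution_on X {-d<..<d} \<psi>" "\<psi> 0 = y" "\<psi> ` {-d<..<d} \<subseteq> cball (\<phi> a) R"
          using flow[of y] y by auto
        have "(\<lambda>t. h (\<psi> t)) constant_on {-d<..<d}"
          using h \<psi>(1) by (auto simp: conserved_quantity_def)
        then have "h (\<psi> ?\<tau>) = h y"
          using \<psi>(2) \<tau> d(1) by (force simp: constant_on_def)
        moreover have "dist (\<psi> ?\<tau>) (\<phi> (c + ?\<tau>)) \<le> 2 * dist (\<psi> 0) (\<phi> (c + 0))"
        proof (rule solutions_stable_short_time[OF lip])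
          show "L * \<bar>?\<tau> - 0\<bar> \<le> 1/2"
            using mult_left_mono[of "\<bar>?\<tau>\<bar>" d L] \<tau> L d by simp
          fix u assume "u \<in> closed_segment 0 ?\<tau>"
          from seg[OF this] have u: "u \<in> {-d<..<d}" "c + u \<in> I" "\<phi> (c + u) \<in> ball (\<phi> a) (R/2)"
            using e1(2)[of "c + u"] e by auto
          show "(\<psi> has_vector_derivative X (\<psi> u)) (at u)"
            using \<psi>(1) u by (auto simp: solution_on_def)
          have "((\<phi> \<circ> (\<lambda>u. c + u)) has_vector_derivative (1 *\<^sub>R X (\<phi> (c + u)))) (at u)"
            using \<phi> u(2) unfolding solution_on_def
            by (intro vector_diff_chain_at) (auto intro!: derivative_eq_intros)
          then show "((\<lambda>u. \<phi> (c + u)) has_vector_derivative X (\<phi> (c + u))) (at u)"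
            by (simp add: o_def)
          show "\<psi> u \<in> cball (\<phi> a) R"
            using \<psi>(3) u(1) by blast
          show "\<phi> (c + u) \<in> cball (\<phi> a) R"
            using u(3) R by simp
        qed
        ultimately show ?thesis
          using \<psi>(2) by auto
      qed
      have c_in: "\<phi> c \<in> ball (\<phi> a) (R/2)"
        using e1(2)[of c] c e by auto
      then obtain r where r: "0 < r" "ball (\<phi> c) r \<subseteq> ball (\<phi> a) (R/2)"
        using open_ball openE by blast
      have h_bc: "h (\<phi> b) = h (\<phi> c)"
        using near[OF c_in] by auto
      have "\<exists>\<delta>>0. \<forall>y. norm (y - \<phi> c) < \<delta> \<longrightarrow> norm (h y - h (\<phi> c)) \<le> \<epsilon> * norm (y - \<phi> c)"
        if \<epsilon>: "0 < \<epsilon>" for \<epsilon>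
      proof -
        obtain \<delta> where \<delta>: "0 < \<delta>"
          "\<And>y. norm (y - \<phi> b) < \<delta> \<Longrightarrow> norm (h y - h (\<phi> b)) \<le> \<epsilon>/2 * norm (y - \<phi> b)"
          using crit_b \<epsilon> unfolding has_derivative_at_alt
          by (metis (no_types, lifting) diff_zero half_gt_zero)
        have "norm (h y - h (\<phi> c)) \<le> \<epsilon> * norm (y - \<phi> c)" if y: "norm (y - \<phi> c) < min r (\<delta>/2)" for y
        proof -
          obtain y' where y': "h y' = h y" "norm (y' - \<phi> b) \<le> 2 * norm (y - \<phi> c)"
            using near[of y] y r(2) by (auto simp: dist_norm norm_minus_commute subset_eq)
          have "norm (h y - h (\<phi> c)) \<le> \<epsilon>/2 * norm (y' - \<phi> b)"
            using \<delta>(2)[of y'] y y' h_bc by auto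
          also have "\<dots> \<le> \<epsilon>/2 * (2 * norm (y - \<phi> c))"
            using y'(2) \<epsilon> by (intro mult_left_mono) auto
          finally show ?thesis by simp
        qed
        then show ?thesis
          using r(1) \<delta>(1) by (intro exI[of _ "min r (\<delta>/2)"]) auto
      qed
      then show ?thesis
        by (simp add: has_derivative_at_alt)
    qed
    have "?crit a = ?crit b" if "\<bar>b - a\<bar> < e" for b
      using carry[of a b] carry[of b a] that e(1) by auto
    then show "eventually (\<lambda>b. ?crit a = ?crit b) (at a within I)"
      using e(1) by (auto simp: eventually_at dist_real_def intro!: exI[of _ e])
  qed
  then show ?thesis using crit by simp
qed

lemma GDERIV_gradient:
  fixes f :: "'a::euclidean_space \<Rightarrow> real"
  assumes "f differentiable (at x)"
  shows "GDERIV f x :> gradient f x"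
proof -
  obtain f' where f': "(f has_derivative f') (at x)"
    using assms by (auto simp: differentiable_def)
  have "f' = (\<lambda>h. h \<bullet> adjoint f' 1)"
    using adjoint_works[OF has_derivative_linear[OF f'], of _ 1] by auto
  then have "GDERIV f x :> adjoint f' 1"
    using f' by (simp add: gderiv_def)
  moreover from this have "gradient f x = adjoint f' 1"
    by (rule gradient_eqI)
  ultimately show ?thesis by simp
qed

text \<open>
  The derivative of \<open>f\<close> along a solution is \<open>\<nabla>f \<bullet> X\<close>. The direction from left to right depends on
  the existence of solutions: without a solution through \<open>x\<close>, conservation would say nothing about
  \<open>\<nabla>f\<close> at \<open>x\<close>.
\<close>

lemma conserved_quantity_iff_gradient_orthogonal:
  fixes X :: "'a::euclidean_space \<Rightarrow> 'a" and f :: "'a \<Rightarrow> real"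
  assumes X: "locally_lipschitz X" and f: "\<And>x. f differentiable (at x)"
  shows "conserved_quantity X f \<longleftrightarrow> (\<forall>x. gradient f x \<bullet> X x = 0)"
proof -
  have f_\<phi>: "((\<lambda>t. f (\<phi> t)) has_vector_derivative gradient f (\<phi> t) \<bullet> X (\<phi> t)) (at t)"
    if "solution_on X I \<phi>" "t \<in> I" for I \<phi> t
  proof -
    have "(\<phi> has_derivative (\<lambda>h. h *\<^sub>R X (\<phi> t))) (at t)"
      using that by (auto simp: solution_on_def has_vector_derivative_def)
    from has_derivative_compose[OF this GDERIV_gradient[OF f, unfolded gderiv_def]]
    show ?thesis
      by (simp add: has_vector_derivative_def inner_commute)
  qed
  show ?thesis
  proof
    assume cons: "conserved_quantity X f"
    show "\<forall>x. gradient f x \<bullet> X x = 0"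
    proof
      fix x
      obtain I \<phi> where \<phi>: "solution_on X I \<phi>" "0 \<in> I" "\<phi> 0 = x"
        using solution_through_point[OF X] .
      obtain k where k: "\<And>t. t \<in> I \<Longrightarrow> f (\<phi> t) = k"
        using cons \<phi>(1) unfolding conserved_quantity_def constant_on_def by metis
      have "open I"
        using \<phi>(1) by (simp add: solution_on_def)
      then have "((\<lambda>_. k) has_vector_derivative gradient f x \<bullet> X x) (at 0)"
        using has_vector_derivative_transform_within_open[OF f_\<phi>[OF \<phi>(1,2)], of I] \<phi> k by simp
      then show "gradient f x \<bullet> X x = 0"
        using has_vector_derivative_const vector_derivative_unique_at by blast
    qed
  next
    assume orth: "\<forall>x. gradient f x \<bullet> X x = 0"
    show "conserved_quantity X f"
      unfolding conserved_quantity_def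
    proof (intro allI impI)
      fix I \<phi> assume \<phi>: "solution_on X I \<phi>"
      have "\<exists>k. \<forall>t\<in>I. f (\<phi> t) = k"
      proof (rule has_derivative_zero_constant)
        show "convex I"
          using \<phi> by (simp add: solution_on_def is_interval_convex)
        show "((\<lambda>t. f (\<phi> t)) has_derivative (\<lambda>h. 0)) (at t within I)" if "t \<in> I" for t
          using has_vector_derivative_at_within[OF f_\<phi>[OF \<phi> that]] orth
          by (simp add: has_vector_derivative_def)
      qed
      then show "(\<lambda>t. f (\<phi> t)) constant_on I"
        by (simp add: constant_on_def)
    qed
  qed
qed

section \<open>Local Lipschitz continuity of continuously differentiable functions\<close>

lemma C_class_differentiable:
  assumes "C_class q f" "q \<ge> 1"
  shows "f differentiable (at x)"
  using assms by (cases q) auto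

text \<open>
  Only the directional derivatives are known to be continuous, one direction at a time. Bounding
  them on the compact unit ball around \<open>x\<close> in the finitely many basis directions and expanding a
  vector in the basis bounds the operator norm of the derivative there.
\<close>

lemma C_class_1_imp_locally_lipschitz:
  fixes f :: "'a::euclidean_space \<Rightarrow> 'b::real_normed_vector"
  assumes "C_class 1 f"
  shows "locally_lipschitz f"
  unfolding locally_lipschitz_def
proof
  fix x :: 'a
  let ?D = "\<lambda>y. frechet_derivative f (at y)" and ?K = "cball x 1"
  have cont: "continuous_on UNIV (\<lambda>y. ?D y v)" for v
    using assms by simp
  have D: "(f has_derivative ?D y) (at y)" for y
    using C_class_differentiable[OF assms] frechet_derivative_works by blast
  have "\<exists>B. \<forall>y\<in>?K. norm (?D y b) \<le> B" for b
  proof -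
    have "compact ((\<lambda>y. ?D y b) ` ?K)"
      by (intro compact_continuous_image continuous_on_subset[OF cont]) auto
    then show ?thesis
      using compact_imp_bounded by (force simp: bounded_iff)
  qed
  then obtain B where B: "\<And>b y. y \<in> ?K \<Longrightarrow> norm (?D y b) \<le> B b"
    by metis
  let ?L = "\<Sum>b\<in>Basis. B b"
  have B0: "0 \<le> B b" for b
    using B[of x b] norm_ge_zero order_trans by (metis centre_in_cball zero_le_one)
  have "onorm (?D y) \<le> ?L" if y: "y \<in> ?K" for y
  proof (rule onorm_le)
    fix v :: 'a
    interpret linear "?D y"
      using D by (rule has_derivative_linear)
    have "?D y v = ?D y (\<Sum>b\<in>Basis. (v \<bullet> b) *\<^sub>R b)"
      by (simp add: euclidean_representation)
    also have "\<dots> = (\<Sum>b\<in>Basis. (v \<bullet> b) *\<^sub>R ?D y b)"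
      by (simp add: sum scale)
    also have "norm \<dots> \<le> (\<Sum>b\<in>Basis. B b * norm v)"
    proof (rule sum_norm_le)
      fix b :: 'a assume "b \<in> Basis"
      then have "\<bar>v \<bullet> b\<bar> * norm (?D y b) \<le> norm v * B b"
        using B[OF y] by (intro mult_mono Basis_le_norm) auto
      then show "norm ((v \<bullet> b) *\<^sub>R ?D y b) \<le> B b * norm v"
        by (simp add: mult.commute)
    qed
    finally show "norm (?D y v) \<le> ?L * norm v"
      by (simp add: sum_distrib_right)
  qed
  then have "?L-lipschitz_on ?K f"
    by (intro lipschitz_onI)
      (auto simp: dist_norm sum_nonneg B0
        intro!: differentiable_bound[of ?K f ?D] has_derivative_at_withinI[OF D])
  then show "\<exists>R>0. \<exists>L. L-lipschitz_on (cball x R) f"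
    by (intro exI[of _ 1]) auto
qed

section \<open>Orbits along which the gradients agree\<close>

lemma inner_antisymmetric_matrix:
  fixes A :: "real ^ 'n ^ 'n"
  assumes "transpose A = - A"
  shows "u \<bullet> (A *v w) = - (w \<bullet> (A *v u))"
proof -
  have "u \<bullet> (A *v w) = (transpose A *v u) \<bullet> w"
    by (simp add: dot_lmul_matrix)
  also have "transpose A *v u = - (A *v u)"
    unfolding assms by (simp add: matrix_vector_mult_def sum_negf vec_eq_iff)
  finally show ?thesis
    by (simp add: inner_commute)
qed

text \<open>The gradients of \<open>F\<close> and \<open>G\<close> agree exactly at the critical points of \<open>F - G\<close>.\<close>

lemma gradients_agree_along_solution:
  fixes X :: "'a::euclidean_space \<Rightarrow> 'a" and F G :: "'a \<Rightarrow> real"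
  assumes X: "locally_lipschitz X"
    and dF: "\<And>x. F differentiable (at x)" and dG: "\<And>x. G differentiable (at x)"
    and F: "conserved_quantity X F" and G: "conserved_quantity X G"
    and \<phi>: "solution_on X I \<phi>" "s \<in> I" "t \<in> I"
    and eq: "gradient F (\<phi> s) = gradient G (\<phi> s)"
  shows "gradient F (\<phi> t) = gradient G (\<phi> t)"
proof -
  let ?h = "\<lambda>x. F x - G x"
  have h': "(?h has_derivative (\<lambda>v. v \<bullet> (gradient F x - gradient G x))) (at x)" for x
    using has_derivative_diff[OF GDERIV_gradient[OF dF, unfolded gderiv_def]
        GDERIV_gradient[OF dG, unfolded gderiv_def]]
    by (simp add: inner_diff_right)
  have "conserved_quantity X ?h"
    using F G unfolding conserved_quantity_def constant_on_def by metis
  moreover have "(?h has_derivative (\<lambda>_. 0)) (at (\<phi> s))"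
    using h'[of "\<phi> s"] eq by simp
  ultimately have "(?h has_derivative (\<lambda>_. 0)) (at (\<phi> t))"
    using critical_points_propagate[OF X _ \<phi>] by blast
  then have "(\<lambda>v. v \<bullet> (gradient F (\<phi> t) - gradient G (\<phi> t))) = (\<lambda>_. 0)"
    using h' has_derivative_unique by blast
  then have "\<forall>v. v \<bullet> (gradient F (\<phi> t) - gradient G (\<phi> t)) = 0"
    by metis
  then show ?thesis
    by (metis inner_eq_zero_iff right_minus_eq)
qed

theorem corollary3p3:
  fixes q :: nat
    and F G :: "real ^ 'n \<Rightarrow> real"
    and P :: "real ^ 'n \<Rightarrow> real ^ 'n ^ 'n"
  assumes "q \<ge> 1"
    and "C_class q F" and "C_class q G" and "C_class q P"
    and "\<And>x. transpose (P x) = - P x"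
    and "C_class 1 (\<lambda>x. P x *v gradient F x)"
    and "C_class 1 (\<lambda>x. P x *v gradient G x)"
    and "conserved_quantity (\<lambda>x. P x *v gradient F x) G"
  shows "\<forall>x\<in>{x. gradient F x = gradient G x}. \<forall>I\<^sub>F I\<^sub>G \<Phi>\<^sub>F \<Phi>\<^sub>G.
           maximal_solution (\<lambda>x. P x *v gradient F x) x I\<^sub>F \<Phi>\<^sub>F \<and>
           maximal_solution (\<lambda>x. P x *v gradient G x) x I\<^sub>G \<Phi>\<^sub>G \<longrightarrow>
           I\<^sub>F = I\<^sub>G \<and> (\<forall>t\<in>I\<^sub>F. \<Phi>\<^sub>F t = \<Phi>\<^sub>G t)"
proof -
  let ?X\<^sub>F = "\<lambda>x. P x *v gradient F x" and ?X\<^sub>G = "\<lambda>x. P x *v gradient G x"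
  have XF: "locally_lipschitz ?X\<^sub>F" and XG: "locally_lipschitz ?X\<^sub>G"
    using assms(6,7) by (auto intro: C_class_1_imp_locally_lipschitz)
  have dF: "F differentiable (at x)" and dG: "G differentiable (at x)" for x
    using assms(1-3) by (auto intro: C_class_differentiable)
  note antisym = inner_antisymmetric_matrix[OF assms(5)]
  have "u \<bullet> (P x *v u) = 0" for u x
    using antisym[of u x u] by simp
  then have F_XF: "conserved_quantity ?X\<^sub>F F" and G_XG: "conserved_quantity ?X\<^sub>G G"
    by (simp_all add: conserved_quantity_iff_gradient_orthogonal XF XG dF dG)
  have "gradient G x \<bullet> ?X\<^sub>F x = 0" for x
    using assms(8) conserved_quantity_iff_gradient_orthogonal[OF XF dG] by blast
  then have "gradient F x \<bullet> ?X\<^sub>G x = 0" for x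
    using antisym[of "gradient F x" x "gradient G x"] by simp
  then have F_XG: "conserved_quantity ?X\<^sub>G F"
    by (simp add: conserved_quantity_iff_gradient_orthogonal[OF XG dF])
  show ?thesis
  proof (intro ballI allI impI)
    fix x I\<^sub>F I\<^sub>G \<Phi>\<^sub>F \<Phi>\<^sub>G
    assume "x \<in> {x. gradient F x = gradient G x}"
      and "maximal_solution ?X\<^sub>F x I\<^sub>F \<Phi>\<^sub>F \<and> maximal_solution ?X\<^sub>G x I\<^sub>G \<Phi>\<^sub>G"
    then have x: "gradient F x = gradient G x"
      and maxF: "maximal_solution ?X\<^sub>F x I\<^sub>F \<Phi>\<^sub>F" and maxG: "maximal_solution ?X\<^sub>G x I\<^sub>G \<Phi>\<^sub>G"
      by auto
    have \<Phi>F: "solution_on ?X\<^sub>F I\<^sub>F \<Phi>\<^sub>F" "0 \<in> I\<^sub>F" "\<Phi>\<^sub>F 0 = x"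
      and \<Phi>G: "solution_on ?X\<^sub>G I\<^sub>G \<Phi>\<^sub>G" "0 \<in> I\<^sub>G" "\<Phi>\<^sub>G 0 = x"
      using maxF maxG by (auto simp: maximal_solution_def)
    have "gradient F (\<Phi>\<^sub>F t) = gradient G (\<Phi>\<^sub>F t)" if "t \<in> I\<^sub>F" for t
      using gradients_agree_along_solution[OF XF dF dG F_XF assms(8) \<Phi>F(1,2) that] x \<Phi>F(3) by simp
    then have "solution_on ?X\<^sub>G I\<^sub>F \<Phi>\<^sub>F"
      using \<Phi>F(1) by (simp add: solution_on_def)
    \<comment> \<open>On this orbit the two fields coincide, so it is also an orbit of the other field.\<close>
    from maximal_solution_extends_solution[OF XG maxG this \<Phi>F(2,3)]
    have FG: "I\<^sub>F \<subseteq> I\<^sub>G" and agree: "\<And>t. t \<in> I\<^sub>F \<Longrightarrow> \<Phi>\<^sub>F t = \<Phi>\<^sub>G t" .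
    have "gradient F (\<Phi>\<^sub>G t) = gradient G (\<Phi>\<^sub>G t)" if "t \<in> I\<^sub>G" for t
      using gradients_agree_along_solution[OF XG dF dG F_XG G_XG \<Phi>G(1,2) that] x \<Phi>G(3) by simp
    then have "solution_on ?X\<^sub>F I\<^sub>G \<Phi>\<^sub>G"
      using \<Phi>G(1) by (simp add: solution_on_def)
    from maximal_solution_extends_solution(1)[OF XF maxF this \<Phi>G(2,3)]
    have "I\<^sub>G \<subseteq> I\<^sub>F" .
    with FG agree show "I\<^sub>F = I\<^sub>G \<and> (\<forall>t\<in>I\<^sub>F. \<Phi>\<^sub>F t = \<Phi>\<^sub>G t)"
      by blast
  qed
qed

end
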